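(* Consider a pure exchange economy with consumers $\mathcal{I}=\{1,\dots,N\}$, goods $\mathcal{L}=\{1,\dots,M\}$, price set $P=\{p\in\mathbb{R}^M:\|p\|\le 1\}$, non-empty convex closed (not necessarily bounded from below) choice sets $X_i\subset\mathbb{R}^M$, endowments $e_i\in\mathrm{int}\,X_i$ and utility functions $u_i:X_i\to\mathbb{R}$ ($i\in\mathcal{I}$). For $p\in P$ let $$M_i(p)=\{y_i\in X_i : \langle p,y_i-e_i\rangle\le 1-\|p\|\},\qquad M_i(P)=\bigcup_{p\in P}M_i(p).$$ Suppose that for each $i\in\mathcal{I}$: (a) $u_i$ is continuous, quasiconcave and non-satiable over $\mathcal{A}_i$, and the adjusted normal operator $N^a_{-u_i}$ is locally upper sign-continuous and dually lower semi-continuous over the set $\mathrm{co}(M_i(P))$; (b) there exists $\rho_i>0$ such that for any $p\in P$ and any $y_i\in M_i(p)$ with $\|y_i\|>\rho_i$ there exists $z_i\in M_i(p)$ with $\|z_i\|\le\rho_i$ satisfying $u_i(z_i)>u_i(y_i)$. Then the economy admits a Walrasian equilibrium.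
   Context: Norms are Euclidean, $\mathrm{co}$ denotes convex hull. Put $X=\prod_{i\in\mathcal{I}}X_i$ and $S_i(p)=\{y_i\in X_i:\langle p,y_i\rangle\le\langle p,e_i\rangle\}$. Walrasian equilibrium: a pair $(\bar p,\bar y)$ with $\bar p\in P\setminus\{0\}$ and $\bar y=(\bar y_i)_{i\in\mathcal{I}}\in\prod_{i}S_i(\bar p)$ such that $u_i(\bar y_i)=\max_{y_i\in S_i(\bar p)}u_i(y_i)$ for each $i\in\mathcal{I}$ and $\sum_{i\in\mathcal{I}}(\bar y_i^l-e_i^l)=0$ for each $l\in\mathcal{L}$. Rational allocations: $\mathcal{A}=\{y\in X : \sum_{i}(y_i^l-e_i^l)=0\ \forall l\in\mathcal{L},\ u_i(y_i)\ge u_i(e_i)\ \forall i\in\mathcal{I}\}$, and $\mathcal{A}_i$ is the projection of $\mathcal{A}$ on $X_i$. The function $u_i$ is non-satiable over $\mathcal{A}_i$ if for every $y_i\in\mathcal{A}_i$ there is $x_i\in X_i$ with $u_i(x_i)>u_i(y_i)$. Adjusted normal operator: for a convex set $C\subseteq\mathbb{R}^M$, $h:C\to\mathbb{R}$ quasiconcave (i.e. $h(tw+(1-t)v)\ge\min\{h(w),h(v)\}$ for $w,v\in C$, $t\in[0,1]$) and $w\in C$, let $S_{-h(w)}=\{v\in C:(-h)(v)\le(-h)(w)\}$ and $S^<_{-h(w)}=\{v\in C:(-h)(v)<(-h)(w)\}$. If $w\notin\mathrm{argmin}_C(-h)$, put $\rho_w=d(w,S^<_{-h(w)})$ and $S^a_{-h}(w)=S_{-h(w)}\cap\bar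 B(S^<_{-h(w)},\rho_w)$, where $\bar B(A,\rho)=\{v: d(v,A)\le\rho\}$; otherwise $S^a_{-h}(w)=S_{-h(w)}$. Then $N^a_{-h}:C\rightrightarrows\mathbb{R}^M$, $N^a_{-h}(w)=\{w^*\in\mathbb{R}^M:\langle w^*,v-w\rangle\le 0\ \forall v\in S^a_{-h}(w)\}$. Here it is applied with $C=X_i$, $h=u_i$. A map $T$ is dually lower semi-continuous over $K$ if for each $v\in K$ and any sequence $(w_n)$ in $K$ with $w_n\to w$ ($w\in K$): $\liminf_n\sup_{w_n^*\in T(w_n)}\langle w_n^*,v-w_n\rangle\le 0$ implies $\sup_{w^*\in T(w)}\langle w^*,v-w\rangle\le 0$. A map $T$ is upper sign-continuous over a convex set $K$ if for all $w,v\in K$, with $w_s=sw+(1-s)v$: if $\inf_{w_s^*\in T(w_s)}\langle w_s^*,v-w\rangle\ge 0$ for all $s\in(0,1)$, then $\sup_{w^*\in T(w)}\langle w^*,v-w\rangle\ge 0$. A map $T:X_i\rightrightarrows\mathbb{R}^M$ is locally upper sign-continuous at $w\in X_i$ if there are a convex set $\mathcal{O}_w\ni w$ that is open relative to $X_i$ and a map $\psi_w:\mathcal{O}_w\rightrightarrows\mathbb{R}^M$ that is upper sign-continuous over $\mathcal{O}_w$ and such that $\psi_w(\tilde w)$ is a non-empty convex compact subset of $T(\tilde w)\setminus\{0\}$ for every $\tilde w\in\mathcal{O}_w$. It is locally upper sign-continuous over a set if it is so at each point of the set. *)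

theory Defs
  imports "HOL-Analysis.Analysis"
begin

text \<open>
  The goods are indexed by a finite type 'm and the consumers by a finite type 'i, so that the
  commodity space is real ^ 'm. Functions and set-valued maps on a subset C of this space
  are total functions whose values outside C are never used.
\<close>

section \<open>Quasiconcavity and the adjusted normal operator\<close>

definition quasiconcave_on :: "'a::real_vector set \<Rightarrow> ('a \<Rightarrow> real) \<Rightarrow> bool" where
  "quasiconcave_on C h \<longleftrightarrow>
     (\<forall>w\<in>C. \<forall>v\<in>C. \<forall>t\<in>{0..1}. h (t *\<^sub>R w + (1 - t) *\<^sub>R v) \<ge> min (h w) (h v))"

definition sublevel :: "'a set \<Rightarrow> ('a \<Rightarrow> real) \<Rightarrow> 'a \<Rightarrow> 'a set" where
  "sublevel C f w = {v \<in> C. f v \<le> f w}"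

definition strict_sublevel :: "'a set \<Rightarrow> ('a \<Rightarrow> real) \<Rightarrow> 'a \<Rightarrow> 'a set" where
  "strict_sublevel C f w = {v \<in> C. f v < f w}"

text \<open>
  The convention \<open>infdist x {} = 0\<close> is harmless here: if w lies in C and does not minimise f
  over C, then its strict sublevel set is non-empty.
\<close>
definition adjusted_sublevel ::
    "'a::metric_space set \<Rightarrow> ('a \<Rightarrow> real) \<Rightarrow> 'a \<Rightarrow> 'a set" where
  "adjusted_sublevel C f w =
     (if is_arg_min f (\<lambda>v. v \<in> C) w then sublevel C f w
      else sublevel C f w \<inter>
        {v. infdist v (strict_sublevel C f w) \<le> infdist w (strict_sublevel C f w)})"

text \<open>
  The operator attached to a quasiconcave function h is \<open>adjusted_normal C (\<lambda>x. - h x)\<close>.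
\<close>
definition adjusted_normal ::
    "'a::real_inner set \<Rightarrow> ('a \<Rightarrow> real) \<Rightarrow> 'a \<Rightarrow> 'a set" where
  "adjusted_normal C f w = {ws. \<forall>v \<in> adjusted_sublevel C f w. ws \<bullet> (v - w) \<le> 0}"

section \<open>Continuity notions for set-valued maps\<close>

text \<open>
  Suprema and infima are taken in the extended reals, as the values of the operator above are
  unbounded cones; over an empty set they are \<open>-\<infinity>\<close> and \<open>\<infinity>\<close> respectively.
\<close>

definition dually_lsc_on :: "'a::real_inner set \<Rightarrow> ('a \<Rightarrow> 'a set) \<Rightarrow> bool" where
  "dually_lsc_on K T \<longleftrightarrow>
     (\<forall>v\<in>K. \<forall>w\<in>K. \<forall>W::nat \<Rightarrow> 'a. (\<forall>n. W n \<in> K) \<longrightarrow> W \<longlonglongrightarrow> w \<longrightarrow>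
        liminf (\<lambda>n. SUP ws\<in>T (W n). ereal (ws \<bullet> (v - W n))) \<le> 0 \<longrightarrow>
        (SUP ws\<in>T w. ereal (ws \<bullet> (v - w))) \<le> 0)"

definition upper_sign_continuous_on :: "'a::real_inner set \<Rightarrow> ('a \<Rightarrow> 'a set) \<Rightarrow> bool" where
  "upper_sign_continuous_on K T \<longleftrightarrow>
     (\<forall>w\<in>K. \<forall>v\<in>K.
        (\<forall>s\<in>{0<..<1}. (INF ws\<in>T (s *\<^sub>R w + (1 - s) *\<^sub>R v). ereal (ws \<bullet> (v - w))) \<ge> 0) \<longrightarrow>
        (SUP ws\<in>T w. ereal (ws \<bullet> (v - w))) \<ge> 0)"

definition locally_upper_sign_continuous_at ::
    "'a::real_inner set \<Rightarrow> ('a \<Rightarrow> 'a set) \<Rightarrow> 'a \<Rightarrow> bool" where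
  "locally_upper_sign_continuous_at C T w \<longleftrightarrow>
     (\<exists>U \<psi>. convex U \<and> w \<in> U \<and> openin (top_of_set C) U \<and>
        upper_sign_continuous_on U \<psi> \<and>
        (\<forall>x\<in>U. \<psi> x \<noteq> {} \<and> convex (\<psi> x) \<and> compact (\<psi> x) \<and> \<psi> x \<subseteq> T x - {0}))"

section \<open>Pure exchange economies\<close>

definition price_set :: "(real ^ 'm) set" where
  "price_set = {p. norm p \<le> 1}"

definition budget_set :: "(real ^ 'm) set \<Rightarrow> real ^ 'm \<Rightarrow> real ^ 'm \<Rightarrow> (real ^ 'm) set" where
  "budget_set C a p = {y \<in> C. p \<bullet> y \<le> p \<bullet> a}"

text \<open>The set \<open>M\<^sub>i(p)\<close>, for the choice set C and the endowment a of consumer i.\<close>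
definition relaxed_budget_set ::
    "(real ^ 'm) set \<Rightarrow> real ^ 'm \<Rightarrow> real ^ 'm \<Rightarrow> (real ^ 'm) set" where
  "relaxed_budget_set C a p = {y \<in> C. p \<bullet> (y - a) \<le> 1 - norm p}"

definition rational_allocations ::
    "('i::finite \<Rightarrow> (real ^ 'm) set) \<Rightarrow> ('i \<Rightarrow> real ^ 'm) \<Rightarrow> ('i \<Rightarrow> real ^ 'm \<Rightarrow> real) \<Rightarrow>
      ('i \<Rightarrow> real ^ 'm) set" where
  "rational_allocations X e u =
     {y. (\<forall>i. y i \<in> X i) \<and> (\<forall>l. (\<Sum>i\<in>UNIV. y i $ l - e i $ l) = 0) \<and>
         (\<forall>i. u i (y i) \<ge> u i (e i))}"

definition non_satiable_on ::
    "'a set \<Rightarrow> ('a \<Rightarrow> real) \<Rightarrow> 'a set \<Rightarrow> bool" where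
  "non_satiable_on C h A \<longleftrightarrow> (\<forall>y\<in>A. \<exists>x\<in>C. h x > h y)"

definition walrasian_equilibrium ::
    "('i::finite \<Rightarrow> (real ^ 'm) set) \<Rightarrow> ('i \<Rightarrow> real ^ 'm) \<Rightarrow> ('i \<Rightarrow> real ^ 'm \<Rightarrow> real) \<Rightarrow>
      real ^ 'm \<Rightarrow> ('i \<Rightarrow> real ^ 'm) \<Rightarrow> bool" where
  "walrasian_equilibrium X e u p y \<longleftrightarrow>
     p \<in> price_set - {0} \<and>
     (\<forall>i. y i \<in> budget_set (X i) (e i) p) \<and>
     (\<forall>i. \<forall>z \<in> budget_set (X i) (e i) p. u i z \<le> u i (y i)) \<and>
     (\<forall>l. (\<Sum>i\<in>UNIV. y i $ l - e i $ l) = 0)"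

end

theory Submission
  imports Defs
begin

text \<open>
  The price in the unit ball that maximises the value of excess demand and the demands in the
  relaxed budget sets have a fixed point by Kakutani's theorem (obtained here from Brouwer's);
  there excess demand vanishes, as the relaxation \<open>1 - norm p\<close> is zero on the unit sphere.
  To get Walras' law in spite of possibly thick indifference sets, a consumer only picks those
  maximisers that exhaust the relaxed budget or are satiated on the whole choice set. Such
  maximisers form a non-empty convex set with closed graph: if a maximiser is not satiated, moving
  towards a better point keeps the utility by quasiconcavity until the budget is exhausted.
  At the fixed point the allocation is rational, hence nobody is satiated, all budgets are
  exhausted, and summing the budget equations gives \<open>norm p = 1\<close>.
\<close>

section \<open>Kakutani's fixed point theorem\<close>

text \<open>Choose one value of \<open>D\<close> at each point of a finite
  \<open>\<epsilon>\<close>-net and blend these values by a partition of unity. The blend is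
  continuous, so Brouwer applies, and at \<open>x\<close> only net points within
  \<open>\<epsilon>\<close> of \<open>x\<close> carry weight.\<close>

lemma approximate_fixed_point:
  fixes D :: "'a::euclidean_space \<Rightarrow> 'a set"
  assumes S: "compact S" "convex S" "S \<noteq> {}"
    and D: "\<And>x. x \<in> S \<Longrightarrow> D x \<subseteq> S" "\<And>x. x \<in> S \<Longrightarrow> D x \<noteq> {}"
    and "\<epsilon> > 0"
  obtains x where "x \<in> S" "x \<in> convex hull (\<Union>c\<in>S \<inter> ball x \<epsilon>. D c)"
proof -
  obtain d where d: "\<And>x. x \<in> S \<Longrightarrow> d x \<in> D x"
    using bchoice[of S "\<lambda>x y. y \<in> D x"] D(2) by blast
  have "S \<subseteq> (\<Union>c\<in>S. ball c \<epsilon>)" using \<open>\<epsilon> > 0\<close> by auto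
  then obtain K where K: "K \<subseteq> S" "finite K" "S \<subseteq> (\<Union>c\<in>K. ball c \<epsilon>)"
    using compactE_image[OF S(1), of S "\<lambda>c. ball c \<epsilon>"] by auto
  \<comment> \<open>A tent that is positive exactly on \<open>ball c \<epsilon>\<close>; dividing by
    the sum over the net \<open>K\<close> gives the partition of unity.\<close>
  define \<phi> where "\<phi> c x = max 0 (\<epsilon> - dist c x)" for c x :: 'a
  have \<phi>0: "\<phi> c x \<ge> 0" for c x by (simp add: \<phi>_def)
  have pos: "(\<Sum>c\<in>K. \<phi> c x) > 0" if "x \<in> S" for x
  proof -
    obtain c where c: "c \<in> K" "x \<in> ball c \<epsilon>" using K(3) \<open>x \<in> S\<close> by auto
    then have "\<phi> c x > 0" by (simp add: \<phi>_def)
    then show ?thesis using c(1) K(2) \<phi>0 by (meson sum_pos2)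
  qed
  define f where "f x = (\<Sum>c\<in>K. (\<phi> c x / (\<Sum>b\<in>K. \<phi> b x)) *\<^sub>R d c)" for x
  have hull: "f x \<in> convex hull (\<Union>c\<in>S \<inter> ball x \<epsilon>. D c)" if x: "x \<in> S" for x
  proof -
    let ?K = "{c \<in> K. \<phi> c x \<noteq> 0}"
    have eq: "f x = (\<Sum>c\<in>?K. (\<phi> c x / (\<Sum>b\<in>K. \<phi> b x)) *\<^sub>R d c)"
      unfolding f_def by (rule sum.mono_neutral_right) (use K in auto)
    have one: "(\<Sum>c\<in>?K. \<phi> c x / (\<Sum>b\<in>K. \<phi> b x)) = 1"
    proof -
      have "(\<Sum>c\<in>?K. \<phi> c x / (\<Sum>b\<in>K. \<phi> b x)) = (\<Sum>c\<in>K. \<phi> c x / (\<Sum>b\<in>K. \<phi> b x))"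
        by (rule sum.mono_neutral_left) (use K in auto)
      also have "\<dots> = 1"
        using pos[OF x] by (simp flip: sum_divide_distrib)
      finally show ?thesis .
    qed
    have mem: "d c \<in> convex hull (\<Union>c\<in>S \<inter> ball x \<epsilon>. D c)" if "c \<in> ?K" for c
    proof -
      have "c \<in> S \<inter> ball x \<epsilon>"
        using that K(1) by (auto simp: \<phi>_def dist_commute max_def split: if_splits)
      then show ?thesis using d by (intro hull_inc) blast
    qed
    show ?thesis
      unfolding eq
      by (rule convex_sum) (use K one mem \<phi>0 pos[OF x] in \<open>auto intro: less_imp_le\<close>)
  qed
  have "continuous_on S f"
    unfolding f_def \<phi>_def
    by (intro continuous_intros) (use pos in \<open>force simp: \<phi>_def\<close>)
  moreover have "f x \<in> S" if "x \<in> S" for x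
  proof -
    have "convex hull (\<Union>c\<in>S \<inter> ball x \<epsilon>. D c) \<subseteq> S"
      by (rule hull_minimal) (use D(1) S(2) in auto)
    then show ?thesis using hull[OF that] by blast
  qed
  ultimately obtain x where "x \<in> S" "f x = x"
    using brouwer[OF S, of f] by blast
  with hull that show thesis by metis
qed

text \<open>The part of the graph with values outside \<open>U\<close> is compact. Its projection to
  the arguments is therefore closed, and it misses \<open>x\<close>.\<close>

lemma closed_graph_upper_hemicontinuous:
  fixes D :: "'a::euclidean_space \<Rightarrow> 'a set"
  assumes "compact S" and D: "\<And>x. x \<in> S \<Longrightarrow> D x \<subseteq> S"
    and "closed {(x, y). x \<in> S \<and> y \<in> D x}" and "x \<in> S" "open U" "D x \<subseteq> U"
  obtains \<eta> where "\<eta> > 0" "\<And>c. c \<in> S \<Longrightarrow> dist x c < \<eta> \<Longrightarrow> D c \<subseteq> U"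
proof -
  let ?G = "{(x, y). x \<in> S \<and> y \<in> D x}"
  have "compact (S \<times> S \<inter> ?G)" by (intro compact_Int_closed compact_Times assms(1,3))
  moreover have "S \<times> S \<inter> ?G = ?G" using D by auto
  ultimately have "compact ?G" by (rule back_subst[of compact])
  moreover have "closed (UNIV \<times> (- U) :: ('a \<times> 'a) set)"
    using \<open>open U\<close> by (intro closed_Times) auto
  ultimately have "compact (?G \<inter> UNIV \<times> (- U))" by (rule compact_Int_closed)
  then have "compact (fst ` (?G \<inter> UNIV \<times> (- U)))"
    by (intro compact_continuous_image continuous_intros)
  then have "open (- fst ` (?G \<inter> UNIV \<times> (- U)))"
    using compact_imp_closed by blast
  moreover have "x \<in> - fst ` (?G \<inter> UNIV \<times> (- U))" using assms(6) by auto
  ultimately obtain \<eta> where "\<eta> > 0" "ball x \<eta> \<subseteq> - fst ` (?G \<inter> UNIV \<times> (- U))"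
    by (meson open_contains_ball)
  then show thesis by (intro that[of \<eta>]) (force simp: subset_iff image_iff)+
qed

text \<open>Approximate fixed points with radii tending to 0 accumulate at some \<open>x\<close>. If
  \<open>x\<close> were outside \<open>D x\<close>, a hyperplane would strictly separate the two.
  Near \<open>x\<close> all values of \<open>D\<close>, and so their convex hull, would lie on the
  far side, while the approximate fixed points end up on the side of \<open>x\<close>.\<close>

theorem kakutani:
  fixes D :: "'a::euclidean_space \<Rightarrow> 'a set"
  assumes S: "compact S" "convex S" "S \<noteq> {}"
    and D: "\<And>x. x \<in> S \<Longrightarrow> D x \<subseteq> S" "\<And>x. x \<in> S \<Longrightarrow> D x \<noteq> {}" "\<And>x. x \<in> S \<Longrightarrow> convex (D x)"
    and G: "closed {(x, y). x \<in> S \<and> y \<in> D x}"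
  obtains x where "x \<in> S" "x \<in> D x"
proof -
  have "\<exists>x. x \<in> S \<and> x \<in> convex hull (\<Union>c\<in>S \<inter> ball x (inverse (Suc n)). D c)" for n
    by (rule approximate_fixed_point[of S D "inverse (Suc n)"]) (use S D in auto)
  then obtain X where XS: "\<And>n. X n \<in> S"
    and X: "\<And>n. X n \<in> convex hull (\<Union>c\<in>S \<inter> ball (X n) (inverse (Suc n)). D c)"
    by metis
  obtain x r where x: "x \<in> S" and r: "strict_mono r" and lim: "(X \<circ> r) \<longlonglongrightarrow> x"
    using S(1) XS unfolding compact_def by metis
  have "x \<in> D x"
  proof (rule ccontr)
    assume "x \<notin> D x"
    have "closed (Pair x -` {(x, y). x \<in> S \<and> y \<in> D x})"
      by (intro closed_vimage G continuous_intros)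
    then have "closed (D x)" using x by (simp add: vimage_def)
    then obtain a b where ab: "a \<bullet> x < b" "\<And>y. y \<in> D x \<Longrightarrow> a \<bullet> y > b"
      using separating_hyperplane_closed_point[of "D x" x] D(3)[OF x] \<open>x \<notin> D x\<close> by blast
    obtain \<eta> where \<eta>: "\<eta> > 0" "\<And>c. c \<in> S \<Longrightarrow> dist x c < \<eta> \<Longrightarrow> D c \<subseteq> {y. a \<bullet> y > b}"
      using closed_graph_upper_hemicontinuous[OF S(1) D(1) G x open_halfspace_gt[of b a]] ab(2)
      by (metis mem_Collect_eq subsetI)
    \<comment> \<open>One half of \<open>\<eta>\<close> is for the distance from
      \<open>X (r n)\<close> to \<open>x\<close>, the other for the radius of the ball around
      \<open>X (r n)\<close>.\<close>
    have "\<forall>\<^sub>F n in sequentially. dist (X (r n)) x < \<eta> / 2"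
      using lim \<eta>(1) tendstoD[of "X \<circ> r" x sequentially "\<eta> / 2"] by simp
    moreover have "(\<lambda>n. inverse (real (Suc (r n)))) \<longlonglongrightarrow> 0"
      using LIMSEQ_subseq_LIMSEQ[OF LIMSEQ_inverse_real_of_nat r] by (simp add: o_def)
    then have "\<forall>\<^sub>F n in sequentially. inverse (real (Suc (r n))) < \<eta> / 2"
      by (rule order_tendstoD) (use \<eta>(1) in simp)
    moreover have "\<forall>\<^sub>F n in sequentially. a \<bullet> X (r n) < b"
      by (rule order_tendstoD[OF _ ab(1)])
        (use lim in \<open>auto intro!: tendsto_intros simp: o_def\<close>)
    ultimately have "\<forall>\<^sub>F n in sequentially. False"
    proof eventually_elim
      case (elim n)
      have "D c \<subseteq> {y. a \<bullet> y > b}" if "c \<in> S \<inter> ball (X (r n)) (inverse (Suc (r n)))" for c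
      proof (rule \<eta>(2))
        show "dist x c < \<eta>"
          using that elim(1,2) dist_triangle[of x c "X (r n)"] by (simp add: dist_commute)
      qed (use that in auto)
      then have "convex hull (\<Union>c\<in>S \<inter> ball (X (r n)) (inverse (Suc (r n))). D c)
          \<subseteq> {y. a \<bullet> y > b}"
        by (intro hull_minimal convex_halfspace_gt) blast
      then show False using X[of "r n"] elim(3) by fastforce
    qed
    then show False by simp
  qed
  with x that show thesis by blast
qed

section \<open>Demand of a single consumer\<close>

definition exhausting_demand ::
    "(real ^ 'm) set \<Rightarrow> (real ^ 'm \<Rightarrow> real) \<Rightarrow> real ^ 'm \<Rightarrow> real ^ 'm \<Rightarrow> (real ^ 'm) set" where
  "exhausting_demand C h a p =
     {y \<in> relaxed_budget_set C a p. (\<forall>z\<in>relaxed_budget_set C a p. h z \<le> h y) \<and>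
        ((\<forall>x\<in>C. h x \<le> h y) \<or> p \<bullet> (y - a) = 1 - norm p)}"

lemma mem_relaxed_budget_set_endowment:
  "a \<in> C \<Longrightarrow> norm p \<le> 1 \<Longrightarrow> a \<in> relaxed_budget_set C a p"
  by (simp add: relaxed_budget_set_def)

text \<open>A longer point would be beaten within the budget. The bound provides a compact domain
  for the fixed point although \<open>C\<close> may be unbounded.\<close>

lemma exhausting_demand_norm_le:
  assumes "\<forall>y\<in>relaxed_budget_set C a p. norm y > \<rho> \<longrightarrow>
      (\<exists>z\<in>relaxed_budget_set C a p. norm z \<le> \<rho> \<and> h z > h y)"
    and "y \<in> exhausting_demand C h a p"
  shows "norm y \<le> \<rho>"
  using assms unfolding exhausting_demand_def by (fastforce simp: not_le)

text \<open>Two maximisers have equal utility, so they are satiated together or not at all. In the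
  second case both exhaust the budget, and so does every mixture, as expenditure is affine.\<close>

lemma convex_exhausting_demand:
  assumes "convex C" "quasiconcave_on C h"
  shows "convex (exhausting_demand C h a p)"
proof (rule convexI)
  fix x y and s t :: real
  assume x: "x \<in> exhausting_demand C h a p" and y: "y \<in> exhausting_demand C h a p"
    and st: "0 \<le> s" "0 \<le> t" "s + t = 1"
  let ?w = "s *\<^sub>R x + t *\<^sub>R y"
  let ?B = "relaxed_budget_set C a p"
  have xy: "x \<in> ?B" "y \<in> ?B" "x \<in> C" "y \<in> C" "h x = h y"
    using x y by (auto simp: exhausting_demand_def relaxed_budget_set_def intro: antisym)
  have w: "p \<bullet> (?w - a) = s * (p \<bullet> (x - a)) + t * (p \<bullet> (y - a))"
    using st by (simp add: inner_diff_right inner_add_right algebra_simps)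
      (metis distrib_right mult.left_neutral)
  have "p \<bullet> (?w - a) \<le> 1 - norm p"
    unfolding w using convex_bound_le[of "p \<bullet> (x - a)" "1 - norm p" "p \<bullet> (y - a)" s t] xy st
    by (simp add: relaxed_budget_set_def)
  moreover have "?w \<in> C" using assms(1) xy st by (simp add: convexD)
  ultimately have wB: "?w \<in> ?B" by (simp add: relaxed_budget_set_def)
  have t: "t = 1 - s" using st(3) by simp
  have "h ?w \<ge> min (h x) (h y)"
    using assms(2) xy(3,4) st unfolding quasiconcave_on_def t by simp
  then have hw: "h ?w \<ge> h x" using xy(5) by simp
  consider "\<forall>z\<in>C. h z \<le> h x" | "p \<bullet> (x - a) = 1 - norm p" "p \<bullet> (y - a) = 1 - norm p"
    using x y xy(5) by (auto simp: exhausting_demand_def)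
  then have "(\<forall>z\<in>C. h z \<le> h ?w) \<or> p \<bullet> (?w - a) = 1 - norm p"
  proof cases
    case 1
    then show ?thesis using hw by force
  next
    case 2
    have "p \<bullet> (?w - a) = 1 - norm p"
      unfolding w 2 using st(3) by (metis distrib_right mult_1)
    then show ?thesis ..
  qed
  then show "?w \<in> exhausting_demand C h a p"
    using x wB hw by (fastforce simp: exhausting_demand_def)
qed

lemma exhausting_demand_nonempty:
  assumes C: "convex C" "closed C" "a \<in> C" and h: "continuous_on C h" "quasiconcave_on C h"
    and p: "norm p \<le> 1"
    and \<rho>: "\<forall>y\<in>relaxed_budget_set C a p. norm y > \<rho> \<longrightarrow>
      (\<exists>z\<in>relaxed_budget_set C a p. norm z \<le> \<rho> \<and> h z > h y)"
  shows "exhausting_demand C h a p \<noteq> {}"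
proof -
  let ?B = "relaxed_budget_set C a p"
  have B: "?B = C \<inter> {y. p \<bullet> (y - a) \<le> 1 - norm p}" by (auto simp: relaxed_budget_set_def)
  have "closed {y. p \<bullet> (y - a) \<le> 1 - norm p}"
    by (intro closed_Collect_le continuous_intros)
  then have "closed ?B" unfolding B using C(2) by (intro closed_Int)
  then have "compact (?B \<inter> cball 0 \<rho>)" by (rule closed_Int_compact) simp
  \<comment> \<open>Either the endowment itself lies in the ball or \<open>\<rho>\<close> supplies a
    better affordable point that does.\<close>
  moreover have "?B \<inter> cball 0 \<rho> \<noteq> {}"
    using \<rho> mem_relaxed_budget_set_endowment[OF C(3) p] by (cases "norm a > \<rho>") force+
  moreover have "continuous_on (?B \<inter> cball 0 \<rho>) h"
    by (rule continuous_on_subset[OF h(1)]) (auto simp: B)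
  ultimately obtain y where y: "y \<in> ?B" and y_max: "\<forall>z\<in>?B \<inter> cball 0 \<rho>. h z \<le> h y"
    using continuous_attains_sup[of "?B \<inter> cball 0 \<rho>" h] by blast
  \<comment> \<open>Affordable points outside the ball are beaten by affordable points inside it, so
    the maximum over the ball is global on the budget.\<close>
  have max: "h z \<le> h y" if "z \<in> ?B" for z
    using \<rho> y_max that by (metis IntI less_imp_le linorder_not_less mem_cball_0 order_trans)
  show ?thesis
  proof (cases "\<forall>x\<in>C. h x \<le> h y")
    case True
    then show ?thesis using y max by (auto simp: exhausting_demand_def)
  next
    case False
    then obtain x where x: "x \<in> C" "h x > h y" by auto
    let ?g = "\<lambda>t. p \<bullet> (t *\<^sub>R x + (1 - t) *\<^sub>R y - a)"
    \<comment> \<open>The better point \<open>x\<close> is unaffordable while \<open>y\<close> is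
      affordable, so the segment between them meets the budget hyperplane.\<close>
    have "p \<bullet> (x - a) > 1 - norm p"
      using max[of x] x by (force simp: relaxed_budget_set_def not_less)
    moreover have "p \<bullet> (y - a) \<le> 1 - norm p"
      using y by (simp add: relaxed_budget_set_def)
    ultimately have "\<exists>t\<ge>0. t \<le> 1 \<and> ?g t = 1 - norm p"
      by (intro IVT') (auto intro!: continuous_intros)
    then obtain t where t: "0 \<le> t" "t \<le> 1" "?g t = 1 - norm p" by blast
    let ?w = "t *\<^sub>R x + (1 - t) *\<^sub>R y"
    have yC: "y \<in> C" using y by (simp add: relaxed_budget_set_def)
    have "?w \<in> C" using C(1) x(1) yC t by (simp add: convexD)
    then have "?w \<in> ?B" using t(3) by (simp add: relaxed_budget_set_def)
    moreover have "h ?w \<ge> min (h x) (h y)"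
      using h(2) x(1) yC t(1,2) unfolding quasiconcave_on_def by simp
    then have "h ?w \<ge> h y" using x(2) by simp
    ultimately have "?w \<in> exhausting_demand C h a p"
      using max t(3) by (fastforce simp: exhausting_demand_def)
    then show ?thesis by blast
  qed
qed

text \<open>Inside the unit ball the relaxation makes \<open>a\<close> itself strictly affordable.
  On the sphere it vanishes, and interiority of \<open>a\<close> leaves room for a step against the
  price.\<close>

lemma relaxed_budget_slater_point:
  fixes a p :: "real ^ 'm"
  assumes "a \<in> interior C" "norm p \<le> 1"
  obtains s where "s \<in> C" "p \<bullet> (s - a) < 1 - norm p"
proof (cases "norm p < 1")
  case True
  then show thesis using that[of a] assms(1) interior_subset by auto
next
  case False
  then have p: "norm p = 1" using assms(2) by simp
  obtain \<epsilon> where \<epsilon>: "\<epsilon> > 0" "cball a \<epsilon> \<subseteq> C"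
    using assms(1) mem_interior_cball by blast
  show thesis
  proof (rule that[of "a - \<epsilon> *\<^sub>R p"])
    show "a - \<epsilon> *\<^sub>R p \<in> C" using \<epsilon> p by (intro subsetD[OF \<epsilon>(2)]) (simp add: dist_norm)
    show "p \<bullet> (a - \<epsilon> *\<^sub>R p - a) < 1 - norm p"
      using \<epsilon>(1) p by (simp add: dot_square_norm)
  qed
qed

text \<open>A strictly affordable point stays affordable at nearby prices, so the limit is at least
  as good. The Slater point extends this to every affordable point by approximation.\<close>

lemma closed_graph_exhausting_demand:
  assumes C: "convex C" "closed C" "a \<in> interior C" and h: "continuous_on C h"
  shows "closed {(p, y). norm p \<le> 1 \<and> y \<in> exhausting_demand C h a p}"
  unfolding closed_sequential_limits
proof (intro allI impI)
  fix Q l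
  assume Q: "(\<forall>n. Q n \<in> {(p, y). norm p \<le> 1 \<and> y \<in> exhausting_demand C h a p}) \<and> Q \<longlonglongrightarrow> l"
  obtain p y where l: "l = (p, y)" by fastforce
  define P where "P n = fst (Q n)" for n
  define Y where "Y n = snd (Q n)" for n
  have P: "P \<longlonglongrightarrow> p" and Y: "Y \<longlonglongrightarrow> y"
    using tendsto_fst[of Q l] tendsto_snd[of Q l] Q by (auto simp: l P_def[abs_def] Y_def[abs_def])
  have Pn: "norm (P n) \<le> 1" and Yn: "Y n \<in> exhausting_demand C h a (P n)" for n
    using Q by (auto simp: P_def Y_def split_beta)
  have YC: "Y n \<in> C" and Ybud: "P n \<bullet> (Y n - a) \<le> 1 - norm (P n)"
    and Ymax: "\<And>z. z \<in> C \<Longrightarrow> P n \<bullet> (z - a) \<le> 1 - norm (P n) \<Longrightarrow> h z \<le> h (Y n)"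
    and Yex: "(\<forall>x\<in>C. h x \<le> h (Y n)) \<or> P n \<bullet> (Y n - a) = 1 - norm (P n)" for n
    using Yn[of n] by (auto simp: exhausting_demand_def relaxed_budget_set_def)
  have p: "norm p \<le> 1"
    using tendsto_norm[OF P] Pn by (intro LIMSEQ_le_const2) auto
  have yC: "y \<in> C" using C(2) Y YC closed_sequentially by blast
  have val: "(\<lambda>n. P n \<bullet> (Y n - a)) \<longlonglongrightarrow> p \<bullet> (y - a)"
    and rhs: "(\<lambda>n. 1 - norm (P n)) \<longlonglongrightarrow> 1 - norm p"
    by (intro tendsto_intros P Y)+
  have ybud: "p \<bullet> (y - a) \<le> 1 - norm p"
    using val rhs Ybud by (intro LIMSEQ_le) auto
  have hY: "(\<lambda>n. h (Y n)) \<longlonglongrightarrow> h y"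
    using h Y YC yC by (simp add: continuous_on_sequentially o_def)
  obtain s where s: "s \<in> C" "p \<bullet> (s - a) < 1 - norm p"
    using relaxed_budget_slater_point[OF C(3) p] .
  have strict: "h z \<le> h y" if z: "z \<in> C" "p \<bullet> (z - a) < 1 - norm p" for z
  proof -
    have "(\<lambda>n. P n \<bullet> (z - a) - (1 - norm (P n))) \<longlonglongrightarrow> p \<bullet> (z - a) - (1 - norm p)"
      by (intro tendsto_intros P)
    then have "\<forall>\<^sub>F n in sequentially. P n \<bullet> (z - a) - (1 - norm (P n)) < 0"
      by (rule order_tendstoD) (use z in simp)
    then have "\<forall>\<^sub>F n in sequentially. h z \<le> h (Y n)"
      by eventually_elim (use Ymax z(1) in simp)
    then show ?thesis using hY tendsto_lowerbound by fastforce
  qed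
  have max: "h z \<le> h y" if z: "z \<in> C" "p \<bullet> (z - a) \<le> 1 - norm p" for z
  proof -
    \<comment> \<open>A vanishing weight on \<open>s\<close> makes \<open>z\<close> strictly
      affordable; continuity of \<open>h\<close> then recovers \<open>z\<close>.\<close>
    define t where "t n = inverse (real (Suc n))" for n
    define Z where "Z n = (1 - t n) *\<^sub>R z + t n *\<^sub>R s" for n
    have t: "0 < t n" "t n \<le> 1" for n by (auto simp: t_def field_simps)
    have ZC: "Z n \<in> C" for n
      unfolding Z_def using C(1) z s t[of n] by (simp add: convexD)
    have "p \<bullet> (Z n - a) < 1 - norm p" for n
    proof -
      have "p \<bullet> (Z n - a) = (1 - t n) * (p \<bullet> (z - a)) + t n * (p \<bullet> (s - a))"
        by (simp add: Z_def inner_diff_right inner_add_right algebra_simps)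
      also have "\<dots> < (1 - t n) * (1 - norm p) + t n * (1 - norm p)"
        using t[of n] z s by (intro add_le_less_mono mult_left_mono mult_strict_left_mono) auto
      also have "\<dots> = 1 - norm p" by (simp add: algebra_simps)
      finally show ?thesis .
    qed
    then have "h (Z n) \<le> h y" for n using strict ZC by blast
    moreover have "Z \<longlonglongrightarrow> (1 - 0) *\<^sub>R z + 0 *\<^sub>R s"
      unfolding Z_def t_def by (intro tendsto_intros LIMSEQ_inverse_real_of_nat)
    then have "(\<lambda>n. h (Z n)) \<longlonglongrightarrow> h z"
      using h ZC z(1) by (simp add: continuous_on_sequentially o_def)
    ultimately show ?thesis by (intro LIMSEQ_le_const2) auto
  qed
  \<comment> \<open>If some \<open>x\<close> beats \<open>y\<close>, it eventually beats
    \<open>Y n\<close> too. Those terms are unsatiated, hence exhaust their budgets, and the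
    equality passes to the limit.\<close>
  have "p \<bullet> (y - a) = 1 - norm p" if "x \<in> C" "h x > h y" for x
  proof -
    have "\<forall>\<^sub>F n in sequentially. h (Y n) < h x" using order_tendstoD(2)[OF hY that(2)] .
    then have "\<forall>\<^sub>F n in sequentially. P n \<bullet> (Y n - a) = 1 - norm (P n)"
      by eventually_elim (use Yex that(1) in force)
    then have "(\<lambda>n. 1 - norm (P n)) \<longlonglongrightarrow> p \<bullet> (y - a)"
      using val by (rule Lim_transform_eventually[rotated])
    then show ?thesis using rhs LIMSEQ_unique by blast
  qed
  then have "(\<forall>x\<in>C. h x \<le> h y) \<or> p \<bullet> (y - a) = 1 - norm p" by (meson not_le)
  then show "l \<in> {(p, y). norm p \<le> 1 \<and> y \<in> exhausting_demand C h a p}"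
    using p yC ybud max by (auto simp: l exhausting_demand_def relaxed_budget_set_def)
qed

section \<open>Equilibrium\<close>

theorem theorem4p1:
  fixes X :: "'i::finite \<Rightarrow> (real ^ 'm) set"
    and e :: "'i \<Rightarrow> real ^ 'm"
    and u :: "'i \<Rightarrow> real ^ 'm \<Rightarrow> real"
  assumes "\<And>i. X i \<noteq> {}" and "\<And>i. convex (X i)" and "\<And>i. closed (X i)"
    and "\<And>i. e i \<in> interior (X i)"
    and "\<And>i. continuous_on (X i) (u i)"
    and "\<And>i. quasiconcave_on (X i) (u i)"
    and "\<And>i. non_satiable_on (X i) (u i) ((\<lambda>y. y i) ` rational_allocations X e u)"
    and "\<And>i w. w \<in> convex hull (\<Union>p\<in>price_set. relaxed_budget_set (X i) (e i) p) \<Longrightarrow>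
           locally_upper_sign_continuous_at (X i) (adjusted_normal (X i) (\<lambda>x. - u i x)) w"
    and "\<And>i. dually_lsc_on (convex hull (\<Union>p\<in>price_set. relaxed_budget_set (X i) (e i) p))
           (adjusted_normal (X i) (\<lambda>x. - u i x))"
    and "\<And>i. \<exists>\<rho>>0. \<forall>p\<in>price_set. \<forall>y\<in>relaxed_budget_set (X i) (e i) p. norm y > \<rho> \<longrightarrow>
           (\<exists>z\<in>relaxed_budget_set (X i) (e i) p. norm z \<le> \<rho> \<and> u i z > u i y)"
  shows "\<exists>p y. walrasian_equilibrium X e u p y"
proof -
  note X = assms(2,3,4) and u = assms(5,6)
  have eX: "e i \<in> X i" for i using X(3) interior_subset by blast
  obtain \<rho> where \<rho>: "\<And>i p. norm p \<le> 1 \<Longrightarrow> \<forall>y\<in>relaxed_budget_set (X i) (e i) p.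
      norm y > \<rho> i \<longrightarrow> (\<exists>z\<in>relaxed_budget_set (X i) (e i) p. norm z \<le> \<rho> i \<and> u i z > u i y)"
    using assms(10) unfolding price_set_def by (metis mem_Collect_eq)
  let ?F = "\<lambda>i. exhausting_demand (X i) (u i) (e i)"
  define Z where "Z y = (\<Sum>i\<in>UNIV. y $ i - e i)" for y :: "(real ^ 'm) ^ 'i"
  \<comment> \<open>By Cauchy-Schwarz these are the prices in the unit ball that maximise the value
    of \<open>z\<close>; for \<open>z = 0\<close> they form the whole ball.\<close>
  define A where "A z = {q. norm q \<le> 1 \<and> q \<bullet> z = norm z}" for z :: "real ^ 'm"
  define B where "B = {y :: (real ^ 'm) ^ 'i. \<forall>i. norm (y $ i) \<le> \<rho> i}"
  \<comment> \<open>The price responds to the current allocation and the allocation to the current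
    price.\<close>
  define D where "D x = A (Z (snd x)) \<times> {y. \<forall>i. y $ i \<in> ?F i (fst x)}" for x
  let ?S = "cball (0 :: real ^ 'm) 1 \<times> B"
  have F_ne: "?F i p \<noteq> {}" if "norm p \<le> 1" for i p
    using exhausting_demand_nonempty[OF X(1,2) eX u that \<rho>[OF that]] .
  have F_B: "y \<in> B" if "norm p \<le> 1" "\<And>i. y $ i \<in> ?F i p" for p y
    using exhausting_demand_norm_le[OF \<rho>[OF that(1)] that(2)] by (simp add: B_def)
  have D_ne: "D x \<noteq> {}" if x: "norm (fst x) \<le> 1" for x
  proof -
    obtain y where "\<And>i. y i \<in> ?F i (fst x)" 
      using choice[of "\<lambda>i y. y \<in> ?F i (fst x)"] F_ne[OF x] by blast
    then have "(\<chi> i. y i) \<in> {y. \<forall>i. y $ i \<in> ?F i (fst x)}" by simp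
    \<comment> \<open>The convention \<open>sgn 0 = 0\<close> covers the case of zero excess
      demand.\<close>
    moreover have "sgn z \<in> A z" for z
      by (simp add: A_def norm_sgn sgn_div_norm dot_square_norm power2_eq_square field_simps)
    ultimately show ?thesis unfolding D_def by blast
  qed
  have "B = (\<Inter>i. {y. norm (y $ i) \<le> \<rho> i})" by (auto simp: B_def)
  moreover have "closed {y :: (real ^ 'm) ^ 'i. norm (y $ i) \<le> \<rho> i}" for i
    by (intro closed_Collect_le continuous_intros)
  ultimately have "closed B" by (simp add: closed_INT)
  moreover have "norm y \<le> (\<Sum>i\<in>UNIV. \<rho> i)" if "y \<in> B" for y
  proof -
    have "norm y \<le> (\<Sum>i\<in>UNIV. norm (y $ i))"
      unfolding norm_vec_def by (rule L2_set_le_sum) simp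
    also have "\<dots> \<le> (\<Sum>i\<in>UNIV. \<rho> i)"
      using that by (intro sum_mono) (simp add: B_def)
    finally show ?thesis .
  qed
  then have "bounded B" unfolding bounded_iff by blast
  ultimately have "compact B" using compact_eq_bounded_closed by blast
  have "convex B"
  proof (rule convexI)
    fix x y and s t :: real assume *: "x \<in> B" "y \<in> B" "0 \<le> s" "0 \<le> t" "s + t = 1"
    have "s *\<^sub>R x $ i + t *\<^sub>R y $ i \<in> cball 0 (\<rho> i)" for i
      using * by (intro convexD[OF convex_cball]) (auto simp: B_def)
    then show "s *\<^sub>R x + t *\<^sub>R y \<in> B" by (simp add: B_def)
  qed
  have "compact ?S" by (intro compact_Times compact_cball \<open>compact B\<close>)
  moreover have "convex ?S" by (intro convex_Times convex_cball \<open>convex B\<close>)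
  \<comment> \<open>Demand at price 0 provides a point of \<open>B\<close>.\<close>
  moreover have "?S \<noteq> {}"
    using D_ne[of "(0, 0)"] F_B[of 0] by (fastforce simp: D_def)
  moreover have "D x \<subseteq> ?S" if "x \<in> ?S" for x
    using that F_B by (auto simp: D_def A_def)
  moreover have "D x \<noteq> {}" if "x \<in> ?S" for x
    by (rule D_ne) (use that in auto)
  moreover have "convex (D x)" if "x \<in> ?S" for x
  proof -
    have "A z = cball 0 1 \<inter> {q. z \<bullet> q = norm z}" for z by (auto simp: A_def inner_commute)
    then have "convex (A z)" for z by (auto intro: convex_Int convex_hyperplane)
    moreover have "convex {y. \<forall>i. y $ i \<in> ?F i (fst x)}"
      using convex_exhausting_demand[OF X(1) u(2)] by (auto simp: convex_def)
    ultimately show ?thesis unfolding D_def by (intro convex_Times)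
  qed
  moreover have "closed {(x, y). x \<in> ?S \<and> y \<in> D x}"
  proof -
    \<comment> \<open>The price in the value is tied to the allocation in the argument, and the
      allocation in the value to the price in the argument; the latter is a preimage of the demand
      graphs.\<close>
    have "{(x, y). x \<in> ?S \<and> y \<in> D x} = (?S \<times> UNIV) \<inter>
        {w. norm (fst (snd w)) \<le> 1} \<inter>
        {w. fst (snd w) \<bullet> Z (snd (fst w)) = norm (Z (snd (fst w)))} \<inter>
        (\<Inter>i. (\<lambda>w. (fst (fst w), snd (snd w) $ i)) -` {(p, y). norm p \<le> 1 \<and> y \<in> ?F i p})"
      by (auto simp: D_def A_def)
    moreover have "closed (?S \<times> (UNIV :: ((real ^ 'm) \<times> ((real ^ 'm) ^ 'i)) set))"
      by (intro closed_Times closed_cball closed_UNIV \<open>closed B\<close>)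
    moreover have "closed {w :: ((real ^ 'm) \<times> ((real ^ 'm) ^ 'i)) \<times> (real ^ 'm) \<times> ((real ^ 'm) ^ 'i).
        norm (fst (snd w)) \<le> 1}"
      by (intro closed_Collect_le continuous_intros)
    moreover have "closed {w :: ((real ^ 'm) \<times> ((real ^ 'm) ^ 'i)) \<times> (real ^ 'm) \<times> ((real ^ 'm) ^ 'i).
        fst (snd w) \<bullet> Z (snd (fst w)) = norm (Z (snd (fst w)))}"
      unfolding Z_def by (intro closed_Collect_eq continuous_intros)
    moreover have "closed ((\<lambda>w :: ((real ^ 'm) \<times> ((real ^ 'm) ^ 'i)) \<times> (real ^ 'm) \<times> ((real ^ 'm) ^ 'i).
        (fst (fst w), snd (snd w) $ i)) -` {(p, y). norm p \<le> 1 \<and> y \<in> ?F i p})" for i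
      by (intro closed_vimage closed_graph_exhausting_demand X u continuous_intros)
    ultimately show ?thesis by (simp only:) (intro closed_Int closed_INT ballI)
  qed
  ultimately obtain x where "x \<in> ?S" "x \<in> D x" by (rule kakutani)
  then obtain p y where p: "norm p \<le> 1" "p \<bullet> Z y = norm (Z y)" and y: "\<And>i. y $ i \<in> ?F i p"
    by (cases x) (auto simp: D_def A_def)
  have bud: "y $ i \<in> X i" "p \<bullet> (y $ i - e i) \<le> 1 - norm p"
    and max: "\<And>z. z \<in> relaxed_budget_set (X i) (e i) p \<Longrightarrow> u i z \<le> u i (y $ i)"
    and ex: "(\<forall>x\<in>X i. u i x \<le> u i (y $ i)) \<or> p \<bullet> (y $ i - e i) = 1 - norm p" for i
    using y[of i] by (auto simp: exhausting_demand_def relaxed_budget_set_def)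
  have pZ: "p \<bullet> Z y = (\<Sum>i\<in>UNIV. p \<bullet> (y $ i - e i))" by (simp add: Z_def inner_sum_right)
  \<comment> \<open>On the sphere the budgets give
    \<open>norm (Z y) = p \<bullet> Z y \<le> 0\<close>. Inside the ball, Cauchy-Schwarz bounds
    \<open>norm (Z y)\<close> by a factor below 1 times itself.\<close>
  have "Z y = 0"
  proof (cases "norm p = 1")
    case True
    then have "p \<bullet> Z y \<le> 0" unfolding pZ using bud(2) by (intro sum_nonpos) simp
    then show ?thesis using p(2) by simp
  next
    case False
    then have "norm p < 1" using p(1) by simp
    moreover have "norm (Z y) \<le> norm p * norm (Z y)"
      using norm_cauchy_schwarz[of p "Z y"] p(2) by simp
    ultimately show ?thesis by (simp add: mult_le_cancel_right1)
  qed
  then have clear: "(\<Sum>i\<in>UNIV. y $ i $ l - e i $ l) = 0" for l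
    by (simp add: Z_def vec_eq_iff)
  \<comment> \<open>Individual rationality holds because the endowment is affordable at every price
    in the ball.\<close>
  have "($) y \<in> rational_allocations X e u"
    using bud(1) clear max[OF mem_relaxed_budget_set_endowment[OF eX p(1)]]
    by (simp add: rational_allocations_def)
  then have "\<exists>x\<in>X i. u i x > u i (y $ i)" for i
    using assms(7)[of i] unfolding non_satiable_on_def by blast
  then have walras: "p \<bullet> (y $ i - e i) = 1 - norm p" for i using ex[of i] by force
  \<comment> \<open>Zero excess demand has zero value; as there is at least one consumer, the common
    slack \<open>1 - norm p\<close> must vanish.\<close>
  have "0 = (\<Sum>i\<in>(UNIV :: 'i set). 1 - norm p)"
    using pZ \<open>Z y = 0\<close> walras by simp
  then have "norm p = 1" by simp
  then have "relaxed_budget_set (X i) (e i) p = budget_set (X i) (e i) p" for i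
    by (simp add: relaxed_budget_set_def budget_set_def inner_diff_right)
  moreover have "p \<noteq> 0" using \<open>norm p = 1\<close> by auto
  ultimately have "walrasian_equilibrium X e u p (($) y)"
    using y max clear p(1)
    by (auto simp: walrasian_equilibrium_def price_set_def exhausting_demand_def)
  then show ?thesis by blast
qed

end
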